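(* Consider the scalar linear system $X_{t+1}=aX_t+bU_t+W_t$, $t\ge1$, with $a,b\ne0$ and $\{W_t\}$ i.i.d. $N(0,\sigma^2)$, $\sigma^2>0$, with quadratic cost $c(x,u)=px^2+qu^2$, $p,q>0$. Suppose $a^2<1$. Fix $R>0$. Let $m_1=m_1(R)$ be the unique positive root of $$p+m(a^2-1)+\frac{(mab)^2}{q+mb^2}(e^{-2R}-1)=0,$$ and let $m_2$ be the unique positive root of $$p+m(a^2-1)-\frac{(mab)^2}{q+mb^2}=0.$$ For $i=1,2$ define $$k_i=-\frac{m_iab}{q+m_ib^2},\qquad \sigma_i^2=\frac{\sigma^2}{1-\left[e^{-2R}a^2+(1-e^{-2R})(a+bk_i)^2\right]}.$$ Then $$J^*(R)\le\min\Big(m_1\sigma^2,\ m_2\sigma^2+(q+m_2b^2)k_2^2\sigma_2^2e^{-2R}\Big).$$ Also, let $\Phi_1,\Phi_2\in\mathcal M(\mathbb R|\mathbb R)$ be the control laws with Gaussian conditional densities $$\varphi_i(u|x)=\gamma\big(u;(1-e^{-2R})k_ix,\ (1-e^{-2R})e^{-2R}k_i^2\sigma_i^2\big),$$ and let $\pi_i=N(0,\sigma_i^2)$, $i=1,2$. Then the first term in the minimum is achieved by $\Phi_1$, i.e. $\langle\pi_1\otimes\Phi_1,c\rangle=m_1\sigma^2$; the second term is achieved by $\Phi_2$, i.e. $\langle\pi_2\otimes\Phi_2,c\rangle=m_2\sigma^2+(q+m_2b^2)k_2^2\sigma_2^2e^{-2R}$; and $\Phi_i\in\mathcal K_{\pi_i}(R)$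 for $i=1,2$. In each case the information constraint is met with equality: $I(\pi_i,\Phi_i)=R$, $i=1,2$.
   Context: $\gamma(\cdot;m,v)$ is the density of the Gaussian distribution $N(m,v)$ with mean $m$ and variance $v$. State and action spaces are $\mathsf X=\mathsf U=\mathbb R$; the controlled transition kernel is $Q(dy|x,u)=\gamma(y;ax+bu,\sigma^2)\,dy$. $\mathcal P(\mathsf X)$ is the set of Borel probability measures, $\mathcal M(\mathsf U|\mathsf X)$ the set of Markov kernels from $\mathsf X$ to $\mathsf U$; $\langle\mu,f\rangle=\int f\,d\mu$; $\mu\Phi(B)=\int\Phi(B|x)\mu(dx)$; $(\mu\otimes\Phi)(A\times B)=\int_A\Phi(B|x)\mu(dx)$. Relative entropy: $D(\mu\|\nu)=\langle\mu,\log\frac{d\mu}{d\nu}\rangle$ if $\mu\ll\nu$, $+\infty$ otherwise (natural log). Mutual information: $I(\mu,\Phi)=D(\mu\otimes\Phi\|\mu\otimes\mu\Phi)$, where the second argument is the product measure. For $\Phi\in\mathcal M(\mathsf U|\mathsf X)$, $Q_\Phi(A|x)=\int Q(A|x,u)\Phi(du|x)$. Let $\mathbb E^\Phi_\mu$ be expectation for the process with $X_1\sim\mu$, $U_t\sim\Phi(\cdot|X_t)$, $X_{t+1}\sim Q(\cdot|X_t,U_t)$, and $\bar J_\mu(\Phi)=\limsup_{T\to\infty}\frac1T\mathbb E^\Phi_\mu[\sum_{t=1}^Tc(X_t,U_t)]$. $\Phi$ is stable if there is $\pi$ with $\pi=\pi Q_\Phi$ and $\bar J_\pi(\Phi)=\langle\pi\otimes\Phi,c\rangle<\infty$;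 $\mathcal K$ is the set of stable $\Phi$; $\mathcal K_\pi=\{\Phi\in\mathcal K:\pi=\pi Q_\Phi\}$; $\mathcal K_\pi(R)=\{\Phi\in\mathcal K_\pi: I(\pi,\Phi)\le R\}$. The steady-state information-constrained value is $$J^*(R)=\inf_{\pi\in\mathcal P(\mathsf X)}\inf_{\Phi\in\mathcal K_\pi(R)}\langle\pi\otimes\Phi,c\rangle$$ (infimum over an empty set is $+\infty$). *)

theory Defs
  imports "HOL-Probability.Probability"
begin

text \<open>Probability measures and Markov kernels on the real line. State and action space are both
  the real line; a control law is a kernel \<open>\<Phi>\<close> with \<open>\<Phi> x = \<Phi>(\<cdot>|x)\<close>, and the controlled transition
  kernel is \<open>Q (x, u) = Q(\<cdot>|x,u)\<close>.\<close>

definition prob_measures :: "real measure set" where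
  "prob_measures = space (prob_algebra borel)"

definition kernels :: "(real \<Rightarrow> real measure) set" where
  "kernels = borel \<rightarrow>\<^sub>M prob_algebra borel"

text \<open>The measure \<open>\<mu> \<otimes> \<Phi>\<close>; see \<open>emeasure_kernel_prod_Times\<close> for its values on rectangles. The
  output distribution \<open>\<mu>\<Phi>\<close> is the library's \<open>\<mu> \<bind> \<Phi>\<close>.\<close>

definition kernel_prod :: "real measure \<Rightarrow> (real \<Rightarrow> real measure) \<Rightarrow> (real \<times> real) measure"
  (infixr \<open>\<otimes>\<^sub>K\<close> 70) where
  "\<mu> \<otimes>\<^sub>K \<Phi> = \<mu> \<bind> (\<lambda>x. \<Phi> x \<bind> (\<lambda>u. return (borel \<Otimes>\<^sub>M borel) (x, u)))"

definition gaussian :: "real \<Rightarrow> real \<Rightarrow> real measure" where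
  "gaussian m v = density lborel (\<lambda>y. ennreal (normal_density m (sqrt v) y))"
  \<comment> \<open>parametrised by the variance, whereas \<open>normal_density\<close> takes the standard deviation\<close>


text \<open>Relative entropy in nats, with values in the extended reals. If \<open>\<mu> \<lless> \<nu>\<close> are probability
  measures, the negative part of \<open>ln (d\<mu>/d\<nu>)\<close> is always \<open>\<mu>\<close>-integrable, so failure of
  integrability means that the integral is \<open>+\<infinity>\<close>. Note the argument order of the library's
  \<open>KL_divergence\<close>, which takes the reference measure \<open>\<nu>\<close> first.\<close>

definition relative_entropy :: "'a measure \<Rightarrow> 'a measure \<Rightarrow> ereal" where
  "relative_entropy \<mu> \<nu> =
    (if absolutely_continuous \<nu> \<mu> \<and> integrable \<mu> (entropy_density (exp 1) \<nu> \<mu>)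
     then ereal (KL_divergence (exp 1) \<nu> \<mu>) else \<infinity>)"

definition mutual_info :: "real measure \<Rightarrow> (real \<Rightarrow> real measure) \<Rightarrow> ereal" where
  "mutual_info \<mu> \<Phi> = relative_entropy (\<mu> \<otimes>\<^sub>K \<Phi>) (\<mu> \<Otimes>\<^sub>M (\<mu> \<bind> \<Phi>))"


text \<open>The controlled process. Coordinate \<open>n\<close> of a path is the state-action pair
  \<open>(X\<^sub>t, U\<^sub>t)\<close> with \<open>t = n + 1\<close>; the law of the whole path is given by the Ionescu-Tulcea theorem.\<close>

definition step_kernel ::
  "(real \<times> real \<Rightarrow> real measure) \<Rightarrow> real measure \<Rightarrow> (real \<Rightarrow> real measure)
    \<Rightarrow> nat \<Rightarrow> (nat \<Rightarrow> real \<times> real) \<Rightarrow> (real \<times> real) measure" where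
  "step_kernel Q \<mu> \<Phi> n \<omega> = (if n = 0 then \<mu> \<otimes>\<^sub>K \<Phi> else Q (\<omega> (n - 1)) \<otimes>\<^sub>K \<Phi>)"

definition path_law ::
  "(real \<times> real \<Rightarrow> real measure) \<Rightarrow> real measure \<Rightarrow> (real \<Rightarrow> real measure)
    \<Rightarrow> (nat \<Rightarrow> real \<times> real) measure" where
  "path_law Q \<mu> \<Phi> =
    projective_family.lim UNIV
      (Ionescu_Tulcea.CI (step_kernel Q \<mu> \<Phi>) (\<lambda>_. borel \<Otimes>\<^sub>M borel)) (\<lambda>_. borel \<Otimes>\<^sub>M borel)"

text \<open>Costs are nonnegative, so all expected costs live in the extended nonnegative reals.\<close>

definition expected_cost ::
  "(real \<times> real \<Rightarrow> real) \<Rightarrow> real measure \<Rightarrow> (real \<Rightarrow> real measure) \<Rightarrow> ennreal" where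
  "expected_cost c \<pi> \<Phi> = (\<integral>\<^sup>+z. ennreal (c z) \<partial>(\<pi> \<otimes>\<^sub>K \<Phi>))"

definition average_cost ::
  "(real \<times> real \<Rightarrow> real measure) \<Rightarrow> (real \<times> real \<Rightarrow> real)
    \<Rightarrow> real measure \<Rightarrow> (real \<Rightarrow> real measure) \<Rightarrow> ennreal" where
  "average_cost Q c \<mu> \<Phi> =
    limsup (\<lambda>T. (\<integral>\<^sup>+\<omega>. ennreal (\<Sum>n<T. c (\<omega> n)) \<partial>path_law Q \<mu> \<Phi>) / of_nat T)"

definition closed_loop ::
  "(real \<times> real \<Rightarrow> real measure) \<Rightarrow> (real \<Rightarrow> real measure) \<Rightarrow> real \<Rightarrow> real measure" where
  "closed_loop Q \<Phi> x = \<Phi> x \<bind> (\<lambda>u. Q (x, u))"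

definition invariant ::
  "(real \<times> real \<Rightarrow> real measure) \<Rightarrow> (real \<Rightarrow> real measure) \<Rightarrow> real measure \<Rightarrow> bool" where
  "invariant Q \<Phi> \<pi> \<longleftrightarrow> \<pi> = \<pi> \<bind> closed_loop Q \<Phi>"

definition stable_laws ::
  "(real \<times> real \<Rightarrow> real measure) \<Rightarrow> (real \<times> real \<Rightarrow> real) \<Rightarrow> (real \<Rightarrow> real measure) set" where
  "stable_laws Q c = {\<Phi> \<in> kernels. \<exists>\<pi>\<in>prob_measures. invariant Q \<Phi> \<pi> \<and>
     average_cost Q c \<pi> \<Phi> = expected_cost c \<pi> \<Phi> \<and> expected_cost c \<pi> \<Phi> < \<infinity>}"

definition stable_laws_at ::
  "(real \<times> real \<Rightarrow> real measure) \<Rightarrow> (real \<times> real \<Rightarrow> real) \<Rightarrow> real measure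
    \<Rightarrow> (real \<Rightarrow> real measure) set" where
  "stable_laws_at Q c \<pi> = {\<Phi> \<in> stable_laws Q c. invariant Q \<Phi> \<pi>}"

definition info_stable_laws ::
  "(real \<times> real \<Rightarrow> real measure) \<Rightarrow> (real \<times> real \<Rightarrow> real) \<Rightarrow> real measure \<Rightarrow> real
    \<Rightarrow> (real \<Rightarrow> real measure) set" where
  "info_stable_laws Q c \<pi> R = {\<Phi> \<in> stable_laws_at Q c \<pi>. mutual_info \<pi> \<Phi> \<le> ereal R}"

definition optimal_value ::
  "(real \<times> real \<Rightarrow> real measure) \<Rightarrow> (real \<times> real \<Rightarrow> real) \<Rightarrow> real \<Rightarrow> ennreal" where
  "optimal_value Q c R =
    (INF \<pi>\<in>prob_measures. INF \<Phi>\<in>info_stable_laws Q c \<pi> R. expected_cost c \<pi> \<Phi>)"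


text \<open>The scalar linear-quadratic-Gaussian instance: \<open>X\<^sub>t\<^sub>+\<^sub>1 = a X\<^sub>t + b U\<^sub>t + W\<^sub>t\<close> with
  \<open>W\<^sub>t\<close> i.i.d. \<open>N(0, v)\<close>.\<close>

definition lqg_kernel :: "real \<Rightarrow> real \<Rightarrow> real \<Rightarrow> real \<times> real \<Rightarrow> real measure" where
  "lqg_kernel a b v = (\<lambda>(x, u). gaussian (a * x + b * u) v)"

definition quadratic_cost :: "real \<Rightarrow> real \<Rightarrow> real \<times> real \<Rightarrow> real" where
  "quadratic_cost p q = (\<lambda>(x, u). p * x\<^sup>2 + q * u\<^sup>2)"


text \<open>Sanity checks: \<open>\<mu> \<otimes> \<Phi>\<close> has the defining values on rectangles, and the one-step
  kernels satisfy the hypotheses of the Ionescu-Tulcea theorem, so \<open>path_law\<close> is the intended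
  law.\<close>

lemma kernel_prod_measurable:
  assumes [measurable]: "\<Phi> \<in> kernels"
  shows "(\<lambda>x. \<Phi> x \<bind> (\<lambda>u. return (borel \<Otimes>\<^sub>M borel) (x, u)))
    \<in> borel \<rightarrow>\<^sub>M prob_algebra (borel \<Otimes>\<^sub>M borel)"
proof -
  have [measurable]: "\<Phi> \<in> borel \<rightarrow>\<^sub>M prob_algebra borel"
    using assms by (simp add: kernels_def)
  show ?thesis
    by (rule measurable_bind_prob_space2[where N = borel]) measurable
qed

lemma emeasure_kernel_prod_Times:
  assumes \<mu>: "\<mu> \<in> prob_measures" and \<Phi>: "\<Phi> \<in> kernels"
    and [measurable]: "A \<in> sets borel" "B \<in> sets borel"
  shows "emeasure (\<mu> \<otimes>\<^sub>K \<Phi>) (A \<times> B) = (\<integral>\<^sup>+x\<in>A. emeasure (\<Phi> x) B \<partial>\<mu>)"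
proof -
  have sets_\<mu>: "sets \<mu> = sets borel" and ne: "space \<mu> \<noteq> {}"
    using \<mu> by (auto simp: prob_measures_def space_prob_algebra prob_space.not_empty)
  have \<Phi>x: "sets (\<Phi> x) = sets borel" "space (\<Phi> x) \<noteq> {}" for x
    using measurable_space[OF \<Phi>[unfolded kernels_def], of x]
    by (auto simp: space_prob_algebra prob_space.not_empty)
  have m: "(\<lambda>x. \<Phi> x \<bind> (\<lambda>u. return (borel \<Otimes>\<^sub>M borel) (x, u)))
    \<in> \<mu> \<rightarrow>\<^sub>M subprob_algebra (borel \<Otimes>\<^sub>M borel)"
    using measurable_prob_algebraD[OF kernel_prod_measurable[OF \<Phi>]]
    by (simp cong: measurable_cong_sets add: sets_\<mu>)
  have "emeasure (\<Phi> x \<bind> (\<lambda>u. return (borel \<Otimes>\<^sub>M borel) (x, u))) (A \<times> B)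
      = emeasure (\<Phi> x) B * indicator A x" for x
  proof -
    have "(\<lambda>u. return (borel \<Otimes>\<^sub>M borel) (x, u)) \<in> \<Phi> x \<rightarrow>\<^sub>M subprob_algebra (borel \<Otimes>\<^sub>M borel)"
      by (subst measurable_cong_sets[OF \<Phi>x(1) refl]) measurable
    then have "emeasure (\<Phi> x \<bind> (\<lambda>u. return (borel \<Otimes>\<^sub>M borel) (x, u))) (A \<times> B)
        = (\<integral>\<^sup>+u. indicator A x * indicator B u \<partial>\<Phi> x)"
      by (subst emeasure_bind[OF \<Phi>x(2)]) (auto intro!: nn_integral_cong split: split_indicator)
    also have "\<dots> = emeasure (\<Phi> x) B * indicator A x"
      by (subst nn_integral_cmult_indicator) (auto simp: \<Phi>x mult.commute)
    finally show ?thesis .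
  qed
  then show ?thesis
    unfolding kernel_prod_def by (subst emeasure_bind[OF ne m]) auto
qed

lemma Ionescu_Tulcea_step_kernel:
  assumes \<mu>: "\<mu> \<in> prob_measures" and \<Phi>: "\<Phi> \<in> kernels"
    and Q[measurable]: "Q \<in> borel \<Otimes>\<^sub>M borel \<rightarrow>\<^sub>M prob_algebra borel"
  shows "Ionescu_Tulcea (step_kernel Q \<mu> \<Phi>) (\<lambda>_. borel \<Otimes>\<^sub>M borel)"
proof -
  have 1: "step_kernel Q \<mu> \<Phi> n
      \<in> PiM {0..<n} (\<lambda>_. borel \<Otimes>\<^sub>M borel) \<rightarrow>\<^sub>M prob_algebra (borel \<Otimes>\<^sub>M borel)" for n
  proof -
    have k: "(\<lambda>\<omega>. f \<omega> \<otimes>\<^sub>K \<Phi>) \<in> N \<rightarrow>\<^sub>M prob_algebra (borel \<Otimes>\<^sub>M borel)"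
      if "f \<in> N \<rightarrow>\<^sub>M prob_algebra borel" for f and N :: "(nat \<Rightarrow> real \<times> real) measure"
      unfolding kernel_prod_def
      by (rule measurable_bind_prob_space[OF that kernel_prod_measurable[OF \<Phi>]])
    show ?thesis
    proof (cases n)
      case 0
      then show ?thesis
        using k[of "\<lambda>_. \<mu>"] \<mu> by (simp add: step_kernel_def[abs_def] prob_measures_def)
    next
      case (Suc m)
      then show ?thesis
        by (auto simp: step_kernel_def[abs_def] intro!: k measurable_compose[OF _ Q]
          measurable_component_singleton)
    qed
  qed
  show ?thesis
  proof (rule Ionescu_Tulcea.intro)
    show "step_kernel Q \<mu> \<Phi> n
        \<in> PiM {0..<n} (\<lambda>_. borel \<Otimes>\<^sub>M borel) \<rightarrow>\<^sub>M subprob_algebra (borel \<Otimes>\<^sub>M borel)" for n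
      using 1 by (rule measurable_prob_algebraD)
    show "prob_space (step_kernel Q \<mu> \<Phi> n \<omega>)"
      if "\<omega> \<in> space (PiM {0..<n} (\<lambda>_. borel \<Otimes>\<^sub>M borel))" for n \<omega>
      using measurable_space[OF 1 that] unfolding space_prob_algebra by blast
  qed
qed

end

theory Submission
  imports Defs
begin

text \<open>Write \<open>e = exp (- 2 R)\<close>. Under \<open>X \<sim> N(0, s\<^sub>i)\<close> and \<open>\<Phi>\<^sub>i\<close> the pair \<open>(X, U)\<close> is centred Gaussian with
  \<open>Var U = (1 - e) k\<^sub>i\<^sup>2 s\<^sub>i\<close> and \<open>Var (U | X) = e Var U\<close>. Hence the information is
  \<open>ln (1 / e) / 2 = R\<close>, and the choice of \<open>s\<^sub>i\<close> is exactly the fixed-point equation for the variance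
  of the next state. By invariance every coordinate of the path has law \<open>\<pi>\<^sub>i \<otimes> \<Phi>\<^sub>i\<close>, so the
  long-run average cost equals the one-step cost \<open>s\<^sub>i (p + (1 - e) q k\<^sub>i\<^sup>2)\<close>; eliminating \<open>p\<close>
  through the equation for \<open>m\<^sub>i\<close> gives the two closed forms. That equation has a unique positive
  root because its left-hand side is strictly decreasing on the positive half-line.\<close>

section \<open>Gaussian measures on the line: moments and affine Gaussian channels\<close>

lemma sets_gaussian [simp, measurable_cong]: "sets (gaussian m v) = sets borel"
  by (simp add: gaussian_def)

lemma space_gaussian [simp]: "space (gaussian m v) = UNIV"
  by (simp add: gaussian_def)

lemma prob_space_gaussian: "v > 0 \<Longrightarrow> prob_space (gaussian m v)"
  unfolding gaussian_def by (rule prob_space_normal_density) simp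

lemma gaussian_in_prob_measures: "v > 0 \<Longrightarrow> gaussian m v \<in> prob_measures"
  by (simp add: prob_measures_def space_prob_algebra prob_space_gaussian)

lemma nn_integral_gaussian:
  assumes [measurable]: "f \<in> borel_measurable borel"
  shows "(\<integral>\<^sup>+x. f x \<partial>gaussian m v) = (\<integral>\<^sup>+x. ennreal (normal_density m (sqrt v) x) * f x \<partial>lborel)"
  unfolding gaussian_def by (subst nn_integral_density) auto

text \<open>The normal density is jointly measurable in mean and point, so integrating it over a
  fixed Borel set leaves a measurable function of the mean.\<close>

lemma measurable_gaussian:
  assumes v: "v > 0" and f [measurable]: "f \<in> borel_measurable M"
  shows "(\<lambda>x. gaussian (f x) v) \<in> M \<rightarrow>\<^sub>M prob_algebra borel"
proof (rule measurable_prob_algebraI)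
  show "prob_space (gaussian (f x) v)" for x
    using v by (rule prob_space_gaussian)
  show "(\<lambda>x. gaussian (f x) v) \<in> M \<rightarrow>\<^sub>M subprob_algebra borel"
  proof (rule measurable_subprob_algebra)
    show "subprob_space (gaussian (f x) v)" for x
      using v by (intro prob_space_imp_subprob_space prob_space_gaussian)
  next
    fix A :: "real set" assume [measurable]: "A \<in> sets borel"
    have "(\<lambda>x. \<integral>\<^sup>+y. ennreal (normal_density (f x) (sqrt v) y) * indicator A y \<partial>lborel)
        \<in> borel_measurable M"
      unfolding normal_density_def by measurable
    then show "(\<lambda>x. emeasure (gaussian (f x) v) A) \<in> borel_measurable M"
      unfolding gaussian_def by (simp add: emeasure_density)
  qed simp
qed

text \<open>Expanding \<open>(x - d)^2\<close> about \<open>m\<close> leaves only the central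
  moments 1, 0 and \<open>v\<close>. The free centre \<open>d\<close> and the offset
  \<open>B\<close> let one formula serve the noise moment, the output moment and both layers of the
  cost integral.\<close>

lemma nn_integral_gaussian_quadratic:
  assumes v: "v > 0" and A: "A \<ge> 0" and B: "B \<ge> 0"
  shows "(\<integral>\<^sup>+x. ennreal (A * (x - d)\<^sup>2 + B) \<partial>gaussian m v) = ennreal (A * ((m - d)\<^sup>2 + v) + B)"
proof -
  let ?n = "normal_density m (sqrt v)"
  have sv: "sqrt v > 0" using v by simp
  have 0: "has_bochner_integral lborel ?n 1"
    using normal_moment_even[OF sv, of m 0] by simp
  have 1: "has_bochner_integral lborel (\<lambda>x. ?n x * (x - m)) 0"
    using normal_moment_odd[OF sv, of m 0] by simp
  have 2: "has_bochner_integral lborel (\<lambda>x. ?n x * (x - m)\<^sup>2) v"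
    using normal_moment_even[OF sv, of m 1] v by (simp add: fact_numeral)
  have "has_bochner_integral lborel
      (\<lambda>x. A * (?n x * (x - m)\<^sup>2) + ((2 * A * (m - d)) * (?n x * (x - m)) + (A * (m - d)\<^sup>2 + B) * ?n x))
      (A * v + ((2 * A * (m - d)) * 0 + (A * (m - d)\<^sup>2 + B) * 1))"
    by (intro has_bochner_integral_add has_bochner_integral_mult_right 0 1 2)
  also have "(\<lambda>x. A * (?n x * (x - m)\<^sup>2) + ((2 * A * (m - d)) * (?n x * (x - m)) + (A * (m - d)\<^sup>2 + B) * ?n x))
      = (\<lambda>x. ?n x * (A * (x - d)\<^sup>2 + B))"
    by (rule ext) (simp add: power2_eq_square algebra_simps)
  finally have h: "has_bochner_integral lborel (\<lambda>x. ?n x * (A * (x - d)\<^sup>2 + B)) (A * ((m - d)\<^sup>2 + v) + B)"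
    by (simp add: algebra_simps)
  have "(\<integral>\<^sup>+x. ennreal (A * (x - d)\<^sup>2 + B) \<partial>gaussian m v)
      = (\<integral>\<^sup>+x. ennreal (?n x * (A * (x - d)\<^sup>2 + B)) \<partial>lborel)"
    using A B by (subst nn_integral_gaussian) (auto simp: ennreal_mult')
  also have "\<dots> = ennreal (A * ((m - d)\<^sup>2 + v) + B)"
    using h A B by (subst nn_integral_eq_integral)
      (auto simp: has_bochner_integral_iff)
  finally show ?thesis .
qed

lemma normal_density_shift: "normal_density m \<sigma> (x + d) = normal_density (m - d) \<sigma> x"
  by (simp add: normal_density_def algebra_simps)

lemma normal_density_scale:
  assumes "c \<noteq> 0" and "v > 0"
  shows "\<bar>c\<bar> * normal_density 0 (sqrt (c\<^sup>2 * v)) (c * x) = normal_density 0 (sqrt v) x"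
  using assms
  by (simp add: normal_density_def power_mult_distrib real_sqrt_mult field_simps)

text \<open>With X of law N(m, v) and independent noise W of law N(0, w), this is the law of cX + d
  + W: an affine image followed by a convolution. The gain \<open>c = 0\<close> is treated apart
  because the change of variables needs an invertible scaling.\<close>

lemma bind_gaussian:
  assumes v: "v > 0" and w: "w > 0"
  shows "gaussian m v \<bind> (\<lambda>x. gaussian (c * x + d) w) = gaussian (c * m + d) (c\<^sup>2 * v + w)"
proof (cases "c = 0")
  case True
  then show ?thesis
    using v w by (simp add: bind_const' prob_space_gaussian prob_space_imp_subprob_space)
next
  case False
  have k: "(\<lambda>x. gaussian (c * x + d) w) \<in> gaussian m v \<rightarrow>\<^sub>M subprob_algebra borel"
    by (intro measurable_prob_algebraD measurable_gaussian w) simp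
  have cv: "c\<^sup>2 * v > 0" using False v by simp
  have density: "(\<integral>\<^sup>+x. ennreal (normal_density m (sqrt v) x * normal_density (c * x + d) (sqrt w) y) \<partial>lborel)
      = ennreal (normal_density (c * m + d) (sqrt (c\<^sup>2 * v + w)) y)" for y
  proof -
    let ?z = "y - d - c * m"
    have "(\<integral>\<^sup>+x. ennreal (normal_density m (sqrt v) x * normal_density (c * x + d) (sqrt w) y) \<partial>lborel)
      = (\<integral>\<^sup>+x. ennreal (normal_density m (sqrt v) (m + 1 * x) * normal_density (c * (m + 1 * x) + d) (sqrt w) y) \<partial>lborel)"
      by (subst nn_integral_real_affine[where c = 1 and t = m]) (auto simp: normal_density_def)
    \<comment> \<open>The first normal density is rescaled to the variable \<open>c * x\<close>,
      which produces the Jacobian \<open>\<bar>c\<bar>\<close>. Writing \<open>0 + c * x\<close>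
      matches the affine substitution rule, applied below from right to left to reach a convolution
      of two centred normal densities.\<close>
    also have "\<dots> = (\<integral>\<^sup>+x. ennreal \<bar>c\<bar> * ennreal (normal_density 0 (sqrt w) (?z - (0 + c * x))
        * normal_density 0 (sqrt (c\<^sup>2 * v)) (0 + c * x)) \<partial>lborel)"
    proof (intro nn_integral_cong)
      fix x
      have 1: "normal_density m (sqrt v) (m + 1 * x) = \<bar>c\<bar> * normal_density 0 (sqrt (c\<^sup>2 * v)) (c * x)"
        using normal_density_scale[OF False v, of x] normal_density_shift[of m "sqrt v" x m]
        by (simp add: add.commute)
      have 2: "normal_density (c * (m + 1 * x) + d) (sqrt w) y = normal_density 0 (sqrt w) (?z - c * x)"
        by (simp add: normal_density_def algebra_simps)
      show "ennreal (normal_density m (sqrt v) (m + 1 * x) * normal_density (c * (m + 1 * x) + d) (sqrt w) y)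
        = ennreal \<bar>c\<bar> * ennreal (normal_density 0 (sqrt w) (?z - (0 + c * x)) * normal_density 0 (sqrt (c\<^sup>2 * v)) (0 + c * x))"
        unfolding 1 2 by (simp add: ennreal_mult'[symmetric] ac_simps)
    qed
    also have "\<dots> = ennreal \<bar>c\<bar> * (\<integral>\<^sup>+x. ennreal (normal_density 0 (sqrt w) (?z - (0 + c * x))
        * normal_density 0 (sqrt (c\<^sup>2 * v)) (0 + c * x)) \<partial>lborel)"
      by (rule nn_integral_cmult) measurable
    also have "\<dots> = (\<integral>\<^sup>+x. ennreal (normal_density 0 (sqrt w) (?z - x) * normal_density 0 (sqrt (c\<^sup>2 * v)) x) \<partial>lborel)"
      by (rule nn_integral_real_affine[symmetric]) (use False in auto)
    also have "\<dots> = ennreal (normal_density 0 (sqrt (c\<^sup>2 * v + w)) ?z)"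
      using conv_normal_density_zero_mean[of "sqrt w" "sqrt (c\<^sup>2 * v)", THEN fun_cong, of ?z] cv w
      by (simp add: add.commute del: zero_less_mult_iff)
    also have "normal_density 0 (sqrt (c\<^sup>2 * v + w)) ?z = normal_density (c * m + d) (sqrt (c\<^sup>2 * v + w)) y"
      by (simp add: normal_density_def algebra_simps)
    finally show ?thesis .
  qed
  show ?thesis
  proof (rule measure_eqI)
    show "sets (gaussian m v \<bind> (\<lambda>x. gaussian (c * x + d) w)) = sets (gaussian (c * m + d) (c\<^sup>2 * v + w))"
      by (subst sets_bind[where N = borel]) auto
  next
    fix A assume "A \<in> sets (gaussian m v \<bind> (\<lambda>x. gaussian (c * x + d) w))"
    then have [measurable]: "A \<in> sets borel"
      by (subst (asm) sets_bind[where N = borel]) auto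
    have m: "(\<lambda>x. \<integral>\<^sup>+y. ennreal (normal_density (c * x + d) (sqrt w) y) * indicator A y \<partial>lborel) \<in> borel_measurable borel"
      unfolding normal_density_def by measurable
    have "emeasure (gaussian m v \<bind> (\<lambda>x. gaussian (c * x + d) w)) A
        = (\<integral>\<^sup>+x. \<integral>\<^sup>+y. ennreal (normal_density (c * x + d) (sqrt w) y) * indicator A y \<partial>lborel \<partial>gaussian m v)"
      by (subst emeasure_bind[OF _ k]) (auto simp: gaussian_def emeasure_density)
    also have "\<dots> = (\<integral>\<^sup>+x. \<integral>\<^sup>+y. ennreal (normal_density m (sqrt v) x)
        * (ennreal (normal_density (c * x + d) (sqrt w) y) * indicator A y) \<partial>lborel \<partial>lborel)"
      by (subst nn_integral_gaussian[OF m], rule nn_integral_cong, rule nn_integral_cmult[symmetric]) measurable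
    \<comment> \<open>After exchanging the order of integration the inner integral over
      \<open>x\<close> is the mixture density computed in \<open>density\<close>.\<close>
    also have "\<dots> = (\<integral>\<^sup>+y. \<integral>\<^sup>+x. ennreal (normal_density m (sqrt v) x)
        * (ennreal (normal_density (c * x + d) (sqrt w) y) * indicator A y) \<partial>lborel \<partial>lborel)"
      by (rule lborel_pair.Fubini'[symmetric]) (unfold normal_density_def, measurable)
    also have "\<dots> = (\<integral>\<^sup>+y. ennreal (normal_density (c * m + d) (sqrt (c\<^sup>2 * v + w)) y) * indicator A y \<partial>lborel)"
    proof (intro nn_integral_cong)
      fix y
      have "(\<integral>\<^sup>+x. ennreal (normal_density m (sqrt v) x)
          * (ennreal (normal_density (c * x + d) (sqrt w) y) * indicator A y) \<partial>lborel)
        = (\<integral>\<^sup>+x. ennreal (normal_density m (sqrt v) x * normal_density (c * x + d) (sqrt w) y) * indicator A y \<partial>lborel)"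
        by (intro nn_integral_cong) (simp add: ennreal_mult' mult.assoc)
      also have "\<dots> = (\<integral>\<^sup>+x. ennreal (normal_density m (sqrt v) x * normal_density (c * x + d) (sqrt w) y) \<partial>lborel) * indicator A y"
        by (rule nn_integral_multc) (unfold normal_density_def, measurable)
      finally show "(\<integral>\<^sup>+x. ennreal (normal_density m (sqrt v) x)
          * (ennreal (normal_density (c * x + d) (sqrt w) y) * indicator A y) \<partial>lborel)
        = ennreal (normal_density (c * m + d) (sqrt (c\<^sup>2 * v + w)) y) * indicator A y"
        by (simp only: density)
    qed
    also have "\<dots> = emeasure (gaussian (c * m + d) (c\<^sup>2 * v + w)) A"
      by (simp add: gaussian_def emeasure_density)
    finally show "emeasure (gaussian m v \<bind> (\<lambda>x. gaussian (c * x + d) w)) A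
        = emeasure (gaussian (c * m + d) (c\<^sup>2 * v + w)) A" .
  qed
qed

section \<open>Integration against kernel products and path laws\<close>

lemma sets_prob_measures: "\<mu> \<in> prob_measures \<Longrightarrow> sets \<mu> = sets borel"
  by (simp add: prob_measures_def space_prob_algebra)

lemma kernels_in_prob_measures: "\<Phi> \<in> kernels \<Longrightarrow> \<Phi> x \<in> prob_measures"
  unfolding kernels_def prob_measures_def by (rule measurable_space) auto

lemma kernel_prod_in_prob_algebra:
  assumes "\<mu> \<in> prob_measures" and "\<Phi> \<in> kernels"
  shows "\<mu> \<otimes>\<^sub>K \<Phi> \<in> space (prob_algebra (borel \<Otimes>\<^sub>M borel))"
proof -
  \<comment> \<open>The measure is viewed as a constant kernel on a one-point space, so that the
    composition rule for probability kernels applies.\<close>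
  have "(\<lambda>_::unit. \<mu>) \<in> count_space UNIV \<rightarrow>\<^sub>M prob_algebra borel"
    using assms by (simp add: prob_measures_def)
  from measurable_bind_prob_space[OF this kernel_prod_measurable[OF assms(2)]]
  show ?thesis
    unfolding kernel_prod_def by (auto dest: measurable_space)
qed

lemma measurable_kernel_prod:
  assumes "f \<in> N \<rightarrow>\<^sub>M prob_algebra borel" and "\<Phi> \<in> kernels"
  shows "(\<lambda>x. f x \<otimes>\<^sub>K \<Phi>) \<in> N \<rightarrow>\<^sub>M prob_algebra (borel \<Otimes>\<^sub>M borel)"
  unfolding kernel_prod_def
  by (rule measurable_bind_prob_space[OF assms(1) kernel_prod_measurable[OF assms(2)]])

lemma measurable_nn_integral_kernel:
  assumes \<Phi>: "\<Phi> \<in> kernels" and f [measurable]: "f \<in> borel_measurable (borel \<Otimes>\<^sub>M borel)"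
  shows "(\<lambda>x. \<integral>\<^sup>+u. f (x, u) \<partial>\<Phi> x) \<in> borel_measurable borel"
proof -
  have [measurable]: "\<Phi> \<in> borel \<rightarrow>\<^sub>M subprob_algebra borel"
    using \<Phi> unfolding kernels_def by (rule measurable_prob_algebraD)
  show ?thesis
    by (rule nn_integral_measurable_subprob_algebra2[where N = borel]) measurable
qed

text \<open>Two applications of the integral rule for \<open>bind\<close>: the inner one collapses
  the point mass at \<open>(x, u)\<close>, the outer one integrates over the initial law.\<close>

lemma nn_integral_kernel_prod:
  assumes \<mu>: "\<mu> \<in> prob_measures" and \<Phi>: "\<Phi> \<in> kernels"
    and f [measurable]: "f \<in> borel_measurable (borel \<Otimes>\<^sub>M borel)"
  shows "(\<integral>\<^sup>+z. f z \<partial>(\<mu> \<otimes>\<^sub>K \<Phi>)) = (\<integral>\<^sup>+x. \<integral>\<^sup>+u. f (x, u) \<partial>\<Phi> x \<partial>\<mu>)"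
proof -
  have m: "(\<lambda>x. \<Phi> x \<bind> (\<lambda>u. return (borel \<Otimes>\<^sub>M borel) (x, u)))
    \<in> \<mu> \<rightarrow>\<^sub>M subprob_algebra (borel \<Otimes>\<^sub>M borel)"
    using measurable_prob_algebraD[OF kernel_prod_measurable[OF \<Phi>]]
    by (simp cong: measurable_cong_sets add: sets_prob_measures[OF \<mu>])
  have "(\<integral>\<^sup>+z. f z \<partial>(\<Phi> x \<bind> (\<lambda>u. return (borel \<Otimes>\<^sub>M borel) (x, u)))) = (\<integral>\<^sup>+u. f (x, u) \<partial>\<Phi> x)" for x
  proof -
    have "(\<lambda>u. return (borel \<Otimes>\<^sub>M borel) (x, u)) \<in> \<Phi> x \<rightarrow>\<^sub>M subprob_algebra (borel \<Otimes>\<^sub>M borel)"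
      by (subst measurable_cong_sets[OF sets_prob_measures[OF kernels_in_prob_measures[OF \<Phi>]] refl]) measurable
    then show ?thesis
      by (subst nn_integral_bind[OF f]) (auto intro!: nn_integral_cong nn_integral_return simp: space_pair_measure)
  qed
  then show ?thesis
    unfolding kernel_prod_def by (subst nn_integral_bind[OF f m]) simp
qed

text \<open>The projection of the limit measure to \<open>{n}\<close> is \<open>CI {n}\<close>,
  itself a projection of the finite-horizon law with coordinates below \<open>up_to {n}\<close>.
  This reduces a statement about infinite paths to \<open>n + 1\<close> steps; the constant
  \<open>undefined\<close> function is the empty history.\<close>

lemma (in Ionescu_Tulcea) nn_integral_lim_component:
  assumes f [measurable]: "f \<in> borel_measurable (M n)"
  shows "(\<integral>\<^sup>+\<omega>. f (\<omega> n) \<partial>PF.lim) = (\<integral>\<^sup>+\<omega>. f (\<omega> n) \<partial>C 0 (Suc n) (\<lambda>_. undefined))"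
proof -
  have up: "up_to {n} = Suc n"
    by (rule antisym) (use up_to_less[of "{n}" n] in \<open>auto simp: up_to_iff\<close>)
  have "(\<integral>\<^sup>+\<omega>. f (\<omega> n) \<partial>PF.lim) = (\<integral>\<^sup>+\<omega>. f (\<omega> n) \<partial>distr PF.lim (PiM {n} M) (\<lambda>x. restrict x {n}))"
    by (subst nn_integral_distr)
       (auto intro!: measurable_restrict_subset simp: measurable_cong_sets[OF PF.sets_lim])
  also have "distr PF.lim (PiM {n} M) (\<lambda>x. restrict x {n}) = CI {n}"
    by (rule distr_lim) simp
  also have "(\<integral>\<^sup>+\<omega>. f (\<omega> n) \<partial>CI {n}) = (\<integral>\<^sup>+\<omega>. f (\<omega> n) \<partial>C 0 (Suc n) (\<lambda>_. undefined))"
    unfolding CI_def up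
    by (subst nn_integral_distr)
       (auto intro!: measurable_restrict_subset simp: measurable_cong_sets[OF sets_C] simp del: C.simps)
  finally show ?thesis .
qed

text \<open>\<open>C 0 (Suc n)\<close> extends \<open>C 0 n\<close> by one draw from
  \<open>P n\<close>, and the integrand sees only the coordinate just drawn.\<close>

lemma (in Ionescu_Tulcea) nn_integral_C_last:
  assumes f [measurable]: "f \<in> borel_measurable (M n)"
  shows "(\<integral>\<^sup>+\<omega>. f (\<omega> n) \<partial>C 0 (Suc n) (\<lambda>_. undefined))
    = (\<integral>\<^sup>+\<omega>. \<integral>\<^sup>+z. f z \<partial>P n \<omega> \<partial>C 0 n (\<lambda>_. undefined))"
proof -
  have m: "(\<lambda>\<omega>. f (\<omega> n)) \<in> borel_measurable (PiM {0..<Suc n} M)"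
    by measurable
  have "(\<integral>\<^sup>+\<omega>. f (\<omega> n) \<partial>C 0 (Suc n) (\<lambda>_. undefined))
      = (\<integral>\<^sup>+\<omega>. \<integral>\<^sup>+z. f (z n) \<partial>eP n \<omega> \<partial>C 0 n (\<lambda>_. undefined))"
    by (simp, subst nn_integral_bind[OF m]) (auto simp: measurable_cong_sets[OF sets_C])
  also have "\<dots> = (\<integral>\<^sup>+\<omega>. \<integral>\<^sup>+z. f z \<partial>P n \<omega> \<partial>C 0 n (\<lambda>_. undefined))"
    by (intro nn_integral_cong, subst nn_integral_eP[OF _ m]) (auto simp: space_C)
  finally show ?thesis .
qed

text \<open>Stationarity: the law \<open>\<mu> \<otimes>\<^sub>K \<Phi>\<close> of a state-action
  pair is preserved by one step of the process. Conditioning on the preceding pair replaces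
  \<open>f\<close> by its one-step expectation, so induction carries coordinate \<open>n\<close>
  back to coordinate 0.\<close>

lemma nn_integral_path_law_invariant:
  assumes \<mu>: "\<mu> \<in> prob_measures" and \<Phi>: "\<Phi> \<in> kernels"
    and Q: "Q \<in> borel \<Otimes>\<^sub>M borel \<rightarrow>\<^sub>M prob_algebra borel"
    and inv: "invariant Q \<Phi> \<mu>"
    and f: "f \<in> borel_measurable (borel \<Otimes>\<^sub>M borel)"
  shows "(\<integral>\<^sup>+\<omega>. f (\<omega> n) \<partial>path_law Q \<mu> \<Phi>) = (\<integral>\<^sup>+z. f z \<partial>(\<mu> \<otimes>\<^sub>K \<Phi>))"
proof -
  interpret Ionescu_Tulcea "step_kernel Q \<mu> \<Phi>" "\<lambda>_. borel \<Otimes>\<^sub>M borel"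
    by (rule Ionescu_Tulcea_step_kernel[OF \<mu> \<Phi> Q])
  have Qz: "Q z \<in> prob_measures" for z
    unfolding prob_measures_def by (rule measurable_space[OF Q]) (simp add: space_pair_measure)
  have Qk: "(\<lambda>u. Q (x, u)) \<in> \<Phi> x \<rightarrow>\<^sub>M subprob_algebra borel" for x
    using measurable_compose[OF measurable_Pair1'[of x borel borel] measurable_prob_algebraD[OF Q]]
    by (simp add: measurable_cong_sets[OF sets_prob_measures[OF kernels_in_prob_measures[OF \<Phi>]] refl])
  have cl: "closed_loop Q \<Phi> \<in> \<mu> \<rightarrow>\<^sub>M subprob_algebra borel"
  proof -
    have "(\<lambda>x. \<Phi> x \<bind> (\<lambda>u. Q (x, u))) \<in> borel \<rightarrow>\<^sub>M prob_algebra borel"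
      using \<Phi> Q unfolding kernels_def
      by (intro measurable_bind_prob_space2[where N = borel]) (auto simp: case_prod_eta)
    then show ?thesis
      unfolding closed_loop_def[abs_def]
      by (subst measurable_cong_sets[OF sets_prob_measures[OF \<mu>] refl]) (rule measurable_prob_algebraD)
  qed
  have step: "(\<integral>\<^sup>+z. (\<integral>\<^sup>+y. f y \<partial>(Q z \<otimes>\<^sub>K \<Phi>)) \<partial>(\<mu> \<otimes>\<^sub>K \<Phi>)) = (\<integral>\<^sup>+z. f z \<partial>(\<mu> \<otimes>\<^sub>K \<Phi>))"
    and meas: "(\<lambda>z. \<integral>\<^sup>+y. f y \<partial>(Q z \<otimes>\<^sub>K \<Phi>)) \<in> borel_measurable (borel \<Otimes>\<^sub>M borel)"
    if f: "f \<in> borel_measurable (borel \<Otimes>\<^sub>M borel)" for f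
  proof -
    show meas: "(\<lambda>z. \<integral>\<^sup>+y. f y \<partial>(Q z \<otimes>\<^sub>K \<Phi>)) \<in> borel_measurable (borel \<Otimes>\<^sub>M borel)"
      by (rule measurable_compose[OF measurable_prob_algebraD[OF measurable_kernel_prod[OF Q \<Phi>]]
            nn_integral_measurable_subprob_algebra[OF f]])
    \<comment> \<open>Averaging over the next action leaves a function of the next state alone; its
      integral along \<open>Q\<close> is then governed by \<open>closed_loop\<close>, to which
      invariance applies.\<close>
    define F where "F x = (\<integral>\<^sup>+u. f (x, u) \<partial>\<Phi> x)" for x
    have F: "F \<in> borel_measurable borel"
      unfolding F_def[abs_def] by (rule measurable_nn_integral_kernel[OF \<Phi> f])
    have "(\<integral>\<^sup>+z. (\<integral>\<^sup>+y. f y \<partial>(Q z \<otimes>\<^sub>K \<Phi>)) \<partial>(\<mu> \<otimes>\<^sub>K \<Phi>))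
        = (\<integral>\<^sup>+x. \<integral>\<^sup>+u. \<integral>\<^sup>+y. F y \<partial>Q (x, u) \<partial>\<Phi> x \<partial>\<mu>)"
      by (subst nn_integral_kernel_prod[OF \<mu> \<Phi> meas])
         (simp add: nn_integral_kernel_prod[OF Qz \<Phi> f] F_def[abs_def])
    also have "\<dots> = (\<integral>\<^sup>+x. \<integral>\<^sup>+y. F y \<partial>closed_loop Q \<Phi> x \<partial>\<mu>)"
      unfolding closed_loop_def by (subst nn_integral_bind[OF F Qk]) simp
    also have "\<dots> = (\<integral>\<^sup>+y. F y \<partial>(\<mu> \<bind> closed_loop Q \<Phi>))"
      by (rule nn_integral_bind[OF F cl, symmetric])
    also have "\<dots> = (\<integral>\<^sup>+y. F y \<partial>\<mu>)"
      using inv by (simp add: invariant_def)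
    also have "\<dots> = (\<integral>\<^sup>+z. f z \<partial>(\<mu> \<otimes>\<^sub>K \<Phi>))"
      by (simp add: nn_integral_kernel_prod[OF \<mu> \<Phi> f] F_def)
    finally show "(\<integral>\<^sup>+z. (\<integral>\<^sup>+y. f y \<partial>(Q z \<otimes>\<^sub>K \<Phi>)) \<partial>(\<mu> \<otimes>\<^sub>K \<Phi>)) = (\<integral>\<^sup>+z. f z \<partial>(\<mu> \<otimes>\<^sub>K \<Phi>))" .
  qed
  have "(\<integral>\<^sup>+\<omega>. f (\<omega> n) \<partial>C 0 (Suc n) (\<lambda>_. undefined)) = (\<integral>\<^sup>+z. f z \<partial>(\<mu> \<otimes>\<^sub>K \<Phi>))"
    \<comment> \<open>The test function must vary in the induction, since each step passes to its
      one-step expectation, whose measurability is \<open>meas\<close>.\<close>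
    using f
  proof (induction n arbitrary: f)
    \<comment> \<open>\<open>C 0 0\<close> is the point mass at the empty history, and the first
      draw has law \<open>\<mu> \<otimes>\<^sub>K \<Phi>\<close>.\<close>
    case 0
    show ?case
      by (subst nn_integral_C_last[OF 0])
         (simp add: step_kernel_def nn_integral_return space_PiM sets_PiM_empty)
  next
    \<comment> \<open>Draw \<open>Suc n\<close> depends on the history only through coordinate
      \<open>n\<close>, so the inner integral is a function of that coordinate and falls under the
      induction hypothesis.\<close>
    case (Suc n)
    show ?case
      by (subst nn_integral_C_last[OF Suc.prems])
         (simp add: step_kernel_def Suc.IH[OF meas[OF Suc.prems]] step[OF Suc.prems] del: C.simps)
  qed
  then show ?thesis
    unfolding path_law_def by (simp add: nn_integral_lim_component[OF f])
qed

text \<open>All coordinates have the same expected cost, so the time average is constant in the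
  horizon and the limit superior is trivial. The computation stays in \<open>ennreal\<close>, so it
  also covers infinite cost.\<close>

lemma average_cost_invariant:
  assumes \<mu>: "\<mu> \<in> prob_measures" and \<Phi>: "\<Phi> \<in> kernels"
    and Q: "Q \<in> borel \<Otimes>\<^sub>M borel \<rightarrow>\<^sub>M prob_algebra borel"
    and inv: "invariant Q \<Phi> \<mu>"
    and c [measurable]: "c \<in> borel_measurable (borel \<Otimes>\<^sub>M borel)" and c0: "\<And>z. c z \<ge> 0"
  shows "average_cost Q c \<mu> \<Phi> = expected_cost c \<mu> \<Phi>"
proof -
  interpret Ionescu_Tulcea "step_kernel Q \<mu> \<Phi>" "\<lambda>_. borel \<Otimes>\<^sub>M borel"
    by (rule Ionescu_Tulcea_step_kernel[OF \<mu> \<Phi> Q])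
  have sets: "sets (path_law Q \<mu> \<Phi>) = sets (PiM UNIV (\<lambda>_. borel \<Otimes>\<^sub>M borel))"
    by (simp add: path_law_def)
  have "(\<integral>\<^sup>+\<omega>. ennreal (\<Sum>n<T. c (\<omega> n)) \<partial>path_law Q \<mu> \<Phi>) = of_nat T * expected_cost c \<mu> \<Phi>" for T
  proof -
    have "(\<integral>\<^sup>+\<omega>. ennreal (\<Sum>n<T. c (\<omega> n)) \<partial>path_law Q \<mu> \<Phi>)
        = (\<integral>\<^sup>+\<omega>. (\<Sum>n<T. ennreal (c (\<omega> n))) \<partial>path_law Q \<mu> \<Phi>)"
      using c0 by (simp add: sum_ennreal)
    also have "\<dots> = (\<Sum>n<T. \<integral>\<^sup>+\<omega>. ennreal (c (\<omega> n)) \<partial>path_law Q \<mu> \<Phi>)"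
      by (intro nn_integral_sum) (simp add: measurable_cong_sets[OF sets])
    also have "\<dots> = of_nat T * expected_cost c \<mu> \<Phi>"
      unfolding expected_cost_def
      by (subst nn_integral_path_law_invariant[OF \<mu> \<Phi> Q inv]) auto
    finally show ?thesis .
  qed
  then have "average_cost Q c \<mu> \<Phi> = limsup (\<lambda>T. of_nat T * expected_cost c \<mu> \<Phi> / of_nat T)"
    by (simp add: average_cost_def)
  also have "\<dots> = limsup (\<lambda>T. expected_cost c \<mu> \<Phi>)"
  \<comment> \<open>The quotient simplifies only for positive horizons; the zero denominator at
    \<open>T = 0\<close> is discarded by passing to an eventual equality.\<close>
  proof (rule Limsup_eq)
    show "\<forall>\<^sub>F T in sequentially. of_nat T * expected_cost c \<mu> \<Phi> / of_nat T = expected_cost c \<mu> \<Phi>"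
      using eventually_gt_at_top[of 0]
    proof eventually_elim
      case (elim T)
      then show ?case
        by (subst mult.commute, subst ennreal_mult_divide_eq) auto
    qed
  qed
  finally show ?thesis by (simp add: Limsup_const)
qed

section \<open>Mutual information of a Gaussian channel\<close>

lemma gaussian_in_kernels: "v > 0 \<Longrightarrow> (\<lambda>x. gaussian (c * x) v) \<in> kernels"
  unfolding kernels_def by (rule measurable_gaussian) auto

text \<open>The log-likelihood ratio \<open>L\<close> of the joint law against the product of its
  marginals is a constant plus two squares: the noise and the output, each divided by twice its
  variance. Their means contribute -1/2 and +1/2, which cancel and leave half the log of the
  variance ratio.\<close>

lemma mutual_info_gaussian_channel:
  assumes s: "s > 0" and v: "v > 0"
  shows "mutual_info (gaussian 0 s) (\<lambda>x. gaussian (c * x) v) = ereal (ln ((c\<^sup>2 * s + v) / v) / 2)"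
proof -
  define \<tau> where "\<tau> = c\<^sup>2 * s + v"
  have \<tau>: "\<tau> > 0" using s v by (simp add: \<tau>_def add_nonneg_pos)
  define \<Phi> where "\<Phi> x = gaussian (c * x) v" for x
  have \<Phi>: "\<Phi> \<in> kernels"
    unfolding \<Phi>_def[abs_def] by (rule gaussian_in_kernels[OF v])
  have P: "gaussian 0 s \<in> prob_measures" by (rule gaussian_in_prob_measures[OF s])
  have out: "gaussian 0 s \<bind> \<Phi> = gaussian 0 \<tau>"
    using bind_gaussian[OF s v, of 0 c 0] by (simp add: \<Phi>_def[abs_def] \<tau>_def)
  define M where "M = gaussian 0 s \<Otimes>\<^sub>M gaussian 0 \<tau>"
  define N where "N = gaussian 0 s \<otimes>\<^sub>K \<Phi>"
  define L where "L z = ln (\<tau> / v) / 2 - (snd z - c * fst z)\<^sup>2 / (2 * v) + (snd z)\<^sup>2 / (2 * \<tau>)" for z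
  have sets_M: "sets M = sets (borel \<Otimes>\<^sub>M borel)"
    unfolding M_def by (rule sets_pair_measure_cong) auto
  have N_prob: "N \<in> space (prob_algebra (borel \<Otimes>\<^sub>M borel))"
    unfolding N_def by (rule kernel_prod_in_prob_algebra[OF P \<Phi>])
  then have sets_N: "sets N = sets (borel \<Otimes>\<^sub>M borel)" and "prob_space N"
    by (auto simp: space_prob_algebra)
  note [measurable_cong] = sets_M sets_N
  interpret N: prob_space N by fact
  interpret \<pi>: prob_space "gaussian 0 s" by (rule prob_space_gaussian[OF s])
  interpret \<psi>: prob_space "gaussian 0 \<tau>" by (rule prob_space_gaussian[OF \<tau>])
  interpret M: pair_prob_space "gaussian 0 s" "gaussian 0 \<tau>" ..
  have M_sf: "sigma_finite_measure M"
    unfolding M_def by unfold_locales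
  have L [measurable]: "L \<in> borel_measurable (borel \<Otimes>\<^sub>M borel)"
    unfolding L_def[abs_def] by measurable
  \<comment> \<open>\<open>exp \<circ> L\<close> is the density of the joint law with respect to the product of its marginals\<close>
  have ratio: "normal_density (c * x) (sqrt v) u = normal_density 0 (sqrt \<tau>) u * exp (L (x, u))" for x u
  proof -
    have "exp (ln (\<tau> / v) / 2) = sqrt (\<tau> / v)"
      using \<tau> v by (simp add: ln_sqrt[symmetric])
    moreover have "L (x, u) = ln (\<tau> / v) / 2 + - (u - c * x)\<^sup>2 / (2 * v) + u\<^sup>2 / (2 * \<tau>)"
      by (simp add: L_def)
    ultimately have "exp (L (x, u)) = sqrt (\<tau> / v) * exp (- (u - c * x)\<^sup>2 / (2 * v)) * exp (u\<^sup>2 / (2 * \<tau>))"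
      by (simp only: exp_add)
    then have "normal_density 0 (sqrt \<tau>) u * exp (L (x, u))
      = (1 / sqrt (2 * pi * \<tau>) * sqrt (\<tau> / v)) * exp (- (u - c * x)\<^sup>2 / (2 * v))
        * (exp (- u\<^sup>2 / (2 * \<tau>)) * exp (u\<^sup>2 / (2 * \<tau>)))"
      using \<tau> by (simp add: normal_density_def)
    also have "exp (- u\<^sup>2 / (2 * \<tau>)) * exp (u\<^sup>2 / (2 * \<tau>)) = 1"
      by (simp add: exp_add[symmetric])
    also have "1 / sqrt (2 * pi * \<tau>) * sqrt (\<tau> / v) = 1 / sqrt (2 * pi * v)"
      using \<tau> v by (simp add: real_sqrt_mult real_sqrt_divide)
    finally show ?thesis
      using v by (simp add: normal_density_def)
  qed
  have N_density: "N = density M (\<lambda>z. ennreal (exp (L z)))"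
  proof (rule measure_eqI)
    show "sets N = sets (density M (\<lambda>z. ennreal (exp (L z))))"
      by (simp add: sets_M sets_N)
  next
    fix A assume "A \<in> sets N"
    then have A [measurable]: "A \<in> sets (borel \<Otimes>\<^sub>M borel)"
      by (simp add: sets_N)
    have "emeasure N A = (\<integral>\<^sup>+z. indicator A z \<partial>N)"
      by (simp add: sets_N)
    also have "\<dots> = (\<integral>\<^sup>+x. \<integral>\<^sup>+u. indicator A (x, u) \<partial>\<Phi> x \<partial>gaussian 0 s)"
      unfolding N_def by (rule nn_integral_kernel_prod[OF P \<Phi>]) measurable
    also have "\<dots> = (\<integral>\<^sup>+x. \<integral>\<^sup>+u. ennreal (exp (L (x, u))) * indicator A (x, u) \<partial>gaussian 0 \<tau> \<partial>gaussian 0 s)"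
      unfolding \<Phi>_def
      by (subst (1 2) nn_integral_gaussian; (intro nn_integral_cong)?)
         (auto simp: ratio ennreal_mult' mult.assoc)
    also have "\<dots> = (\<integral>\<^sup>+z. ennreal (exp (L z)) * indicator A z \<partial>M)"
      unfolding M_def by (rule \<psi>.nn_integral_fst) measurable
    also have "\<dots> = emeasure (density M (\<lambda>z. ennreal (exp (L z)))) A"
      by (subst emeasure_density) (auto simp: sets_M)
    finally show "emeasure N A = emeasure (density M (\<lambda>z. ennreal (exp (L z)))) A" .
  qed
  have ac: "absolutely_continuous M N"
    unfolding N_density by (rule absolutely_continuousI_density) measurable
  \<comment> \<open>The Radon-Nikodym derivative is determined only up to \<open>M\<close>-null
    sets; absolute continuity moves the identification to \<open>N\<close>, the measure under which
    the entropy density is integrated.\<close>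
  have "AE z in M. ennreal (exp (L z)) = RN_deriv M N z"
    unfolding N_density by (rule sigma_finite_measure.RN_deriv_unique[OF M_sf]) auto
  then have "AE z in N. ennreal (exp (L z)) = RN_deriv M N z"
    by (rule absolutely_continuous_AE[rotated 2]) (auto simp: sets_M sets_N ac)
  then have ae: "AE z in N. entropy_density (exp 1) M N z = L z"
  proof eventually_elim
    case (elim z)
    then show ?case
      by (simp add: entropy_density_def elim[symmetric] log_def)
  qed
  \<comment> \<open>Computing the nonnegative integral first gives integrability and value
    together.\<close>
  have noise_moment: "has_bochner_integral N (\<lambda>z. (snd z - c * fst z)\<^sup>2) v"
  proof (rule has_bochner_integral_nn_integral)
    have "(\<integral>\<^sup>+z. ennreal ((snd z - c * fst z)\<^sup>2) \<partial>N)
        = (\<integral>\<^sup>+x. \<integral>\<^sup>+u. ennreal ((u - c * x)\<^sup>2) \<partial>\<Phi> x \<partial>gaussian 0 s)"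
      unfolding N_def by (subst nn_integral_kernel_prod[OF P \<Phi>]) auto
    also have "\<dots> = ennreal v"
      using nn_integral_gaussian_quadratic[OF v, of 1 0] by (simp add: \<Phi>_def \<pi>.emeasure_space_1[simplified])
    finally show "(\<integral>\<^sup>+z. ennreal ((snd z - c * fst z)\<^sup>2) \<partial>N) = ennreal v" .
  qed (use v in auto)
  have output_moment: "has_bochner_integral N (\<lambda>z. (snd z)\<^sup>2) \<tau>"
  proof (rule has_bochner_integral_nn_integral)
    have "(\<integral>\<^sup>+z. ennreal ((snd z)\<^sup>2) \<partial>N) = (\<integral>\<^sup>+x. \<integral>\<^sup>+u. ennreal (u\<^sup>2) \<partial>\<Phi> x \<partial>gaussian 0 s)"
      unfolding N_def by (subst nn_integral_kernel_prod[OF P \<Phi>]) auto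
    also have "\<dots> = (\<integral>\<^sup>+x. ennreal (c\<^sup>2 * (x - 0)\<^sup>2 + v) \<partial>gaussian 0 s)"
      using nn_integral_gaussian_quadratic[OF v, of 1 0 _ 0] by (simp add: \<Phi>_def power_mult_distrib)
    also have "\<dots> = ennreal \<tau>"
      using v by (subst nn_integral_gaussian_quadratic[OF s]) (auto simp: \<tau>_def)
    finally show "(\<integral>\<^sup>+z. ennreal ((snd z)\<^sup>2) \<partial>N) = ennreal \<tau>" .
  qed (use \<tau> in auto)
  have const: "has_bochner_integral N (\<lambda>z. ln (\<tau> / v) / 2) (ln (\<tau> / v) / 2)"
    by (simp add: has_bochner_integral_iff N.prob_space)
  have "has_bochner_integral N L (ln (\<tau> / v) / 2 - v / (2 * v) + \<tau> / (2 * \<tau>))"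
    unfolding L_def[abs_def]
    by (intro has_bochner_integral_add has_bochner_integral_diff has_bochner_integral_divide_zero
        noise_moment output_moment const)
  then have "has_bochner_integral N L (ln (\<tau> / v) / 2)"
    using v \<tau> by simp
  moreover have [measurable]: "entropy_density (exp 1) M N \<in> borel_measurable N"
    using measurable_entropy_density[of "exp 1" M N] by (simp add: measurable_cong_sets[OF sets_M refl] measurable_cong_sets[OF sets_N refl])
  ultimately have "has_bochner_integral N (entropy_density (exp 1) M N) (ln (\<tau> / v) / 2)"
    by (subst has_bochner_integral_cong_AE[OF _ _ ae]) auto
  \<comment> \<open>Absolute continuity and integrability select the finite branch of
    \<open>relative_entropy\<close>.\<close>
  then have "relative_entropy N M = ereal (ln (\<tau> / v) / 2)"
    using ac by (simp add: relative_entropy_def KL_divergence_def has_bochner_integral_iff)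
  then show ?thesis
    unfolding mutual_info_def \<Phi>_def[abs_def, symmetric] out M_def[symmetric] N_def[symmetric] \<tau>_def[symmetric] .
qed

section \<open>Linear-quadratic control: stationary Gaussian laws and scalar Riccati
  equations\<close>

lemma measurable_lqg_kernel:
  "v > 0 \<Longrightarrow> lqg_kernel a b v \<in> borel \<Otimes>\<^sub>M borel \<rightarrow>\<^sub>M prob_algebra borel"
  unfolding lqg_kernel_def case_prod_beta by (rule measurable_gaussian) measurable

text \<open>The closed loop is again an affine Gaussian channel, with gain \<open>a + b * c\<close>
  and noise variance \<open>b\<^sup>2 * v + w\<close>; the last hypothesis is the fixed-point
  equation for the state variance.\<close>

lemma invariant_lqg_kernel:
  assumes "s > 0" and "v > 0" and "w > 0"
    and "s = (a + b * c)\<^sup>2 * s + (b\<^sup>2 * v + w)"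
  shows "invariant (lqg_kernel a b w) (\<lambda>x. gaussian (c * x) v) (gaussian 0 s)"
proof -
  have "closed_loop (lqg_kernel a b w) (\<lambda>x. gaussian (c * x) v)
      = (\<lambda>x. gaussian ((a + b * c) * x + 0) (b\<^sup>2 * v + w))"
  proof
    show "closed_loop (lqg_kernel a b w) (\<lambda>x. gaussian (c * x) v) x
        = gaussian ((a + b * c) * x + 0) (b\<^sup>2 * v + w)" for x
      using bind_gaussian[of v w "c * x" b "a * x"] assms
      by (simp add: closed_loop_def lqg_kernel_def algebra_simps)
  qed
  moreover have "b\<^sup>2 * v + w > 0"
    using assms by (simp add: add_nonneg_pos)
  ultimately show ?thesis
    using bind_gaussian[of s "b\<^sup>2 * v + w" 0 "a + b * c" 0] assms
    by (simp add: invariant_def)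
qed

lemma expected_quadratic_cost_gaussian:
  assumes s: "s > 0" and v: "v > 0" and p: "p \<ge> 0" and q: "q \<ge> 0"
  shows "expected_cost (quadratic_cost p q) (gaussian 0 s) (\<lambda>x. gaussian (c * x) v)
    = ennreal ((p + q * c\<^sup>2) * s + q * v)"
proof -
  have "expected_cost (quadratic_cost p q) (gaussian 0 s) (\<lambda>x. gaussian (c * x) v)
      = (\<integral>\<^sup>+x. \<integral>\<^sup>+u. ennreal (q * (u - 0)\<^sup>2 + p * x\<^sup>2) \<partial>gaussian (c * x) v \<partial>gaussian 0 s)"
    unfolding expected_cost_def quadratic_cost_def
    by (subst nn_integral_kernel_prod[OF gaussian_in_prob_measures[OF s] gaussian_in_kernels[OF v]])
       (auto simp: add.commute)
  also have "\<dots> = (\<integral>\<^sup>+x. ennreal (q * ((c * x - 0)\<^sup>2 + v) + p * x\<^sup>2) \<partial>gaussian 0 s)"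
    using p q by (subst nn_integral_gaussian_quadratic[OF v]) auto
  also have "\<dots> = (\<integral>\<^sup>+x. ennreal ((p + q * c\<^sup>2) * (x - 0)\<^sup>2 + q * v) \<partial>gaussian 0 s)"
    by (simp add: algebra_simps power_mult_distrib)
  also have "\<dots> = ennreal ((p + q * c\<^sup>2) * s + q * v)"
    using p q v by (subst nn_integral_gaussian_quadratic[OF s]) auto
  finally show ?thesis .
qed

text \<open>Stability asks for some invariant law with finite matching costs;
  \<open>gaussian 0 s\<close> itself is the witness.\<close>

lemma gaussian_law_stable:
  assumes s: "s > 0" and v: "v > 0" and w: "w > 0" and p: "p \<ge> 0" and q: "q \<ge> 0"
    and eq: "s = (a + b * c)\<^sup>2 * s + (b\<^sup>2 * v + w)"
  shows "(\<lambda>x. gaussian (c * x) v)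
    \<in> stable_laws_at (lqg_kernel a b w) (quadratic_cost p q) (gaussian 0 s)"
proof -
  note P = gaussian_in_prob_measures[OF s] and K = gaussian_in_kernels[OF v]
    and inv = invariant_lqg_kernel[OF s v w eq]
  have "quadratic_cost p q \<in> borel_measurable (borel \<Otimes>\<^sub>M borel)"
    unfolding quadratic_cost_def by measurable
  moreover have "quadratic_cost p q z \<ge> 0" for z
    using p q by (cases z) (simp add: quadratic_cost_def)
  ultimately have "average_cost (lqg_kernel a b w) (quadratic_cost p q) (gaussian 0 s) (\<lambda>x. gaussian (c * x) v)
      = expected_cost (quadratic_cost p q) (gaussian 0 s) (\<lambda>x. gaussian (c * x) v)"
    by (rule average_cost_invariant[OF P K measurable_lqg_kernel[OF w] inv])
  then show ?thesis
    using P K inv by (auto simp: stable_laws_at_def stable_laws_def expected_quadratic_cost_gaussian[OF s v p q])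
qed

text \<open>The weight \<open>t\<close> unifies the two equations:
  \<open>t = 1 - exp (- 2 * R)\<close> for \<open>m 1\<close> and \<open>t = 1\<close> for
  \<open>m 2\<close>. Existence comes from the intermediate value theorem, uniqueness from strict
  monotonicity.\<close>

lemma riccati_unique_root:
  fixes a b p q t :: real
  assumes p: "p > 0" and q: "q > 0" and a: "a\<^sup>2 < 1" and t: "t \<ge> 0"
  shows "\<exists>!x. x > 0 \<and> p + x * (a\<^sup>2 - 1) - t * ((x * a * b)\<^sup>2 / (q + x * b\<^sup>2)) = 0"
proof -
  define f where "f x = p + x * (a\<^sup>2 - 1) - t * ((x * a * b)\<^sup>2 / (q + x * b\<^sup>2))" for x
  have den: "q + x * b\<^sup>2 > 0" if "x \<ge> 0" for x
    using that q by (simp add: add_pos_nonneg)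
  have mono: "(x * a * b)\<^sup>2 / (q + x * b\<^sup>2) \<le> (y * a * b)\<^sup>2 / (q + y * b\<^sup>2)" if "0 < x" "x < y" for x y
  proof -
    \<comment> \<open>The cross-multiplied form of the claim without the factor
      \<open>(a * b)\<^sup>2\<close>; each of the two summands is monotone separately.\<close>
    have "x\<^sup>2 * (q + y * b\<^sup>2) \<le> y\<^sup>2 * (q + x * b\<^sup>2)"
    proof -
      have "x\<^sup>2 * q \<le> y\<^sup>2 * q" using that q by (intro mult_right_mono power_mono) auto
      moreover have "x * (x * y * b\<^sup>2) \<le> y * (x * y * b\<^sup>2)" using that by (intro mult_right_mono) auto
      ultimately show ?thesis by (simp add: power2_eq_square algebra_simps)
    qed
    then have "(a * b)\<^sup>2 * (x\<^sup>2 * (q + y * b\<^sup>2)) \<le> (a * b)\<^sup>2 * (y\<^sup>2 * (q + x * b\<^sup>2))"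
      by (intro mult_left_mono) auto
    then show ?thesis
      using that den[of x] den[of y] by (subst frac_le_eq) (auto simp: divide_simps power_mult_distrib mult_ac)
  qed
  have dec: "f y < f x" if "0 < x" "x < y" for x y
  proof -
    have "y * (a\<^sup>2 - 1) < x * (a\<^sup>2 - 1)" using that a by simp
    moreover have "t * ((x * a * b)\<^sup>2 / (q + x * b\<^sup>2)) \<le> t * ((y * a * b)\<^sup>2 / (q + y * b\<^sup>2))"
      using mono[OF that] t by (rule mult_left_mono)
    ultimately show ?thesis unfolding f_def by linarith
  qed
  \<comment> \<open>The zero of the affine part. There only the nonpositive term of \<open>f\<close>
    remains, while \<open>f 0 = p\<close> is positive, so \<open>f\<close> changes sign on
    \<open>{0..z}\<close>.\<close>
  define z where "z = p / (1 - a\<^sup>2)"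
  have z: "z > 0" using p a by (simp add: z_def)
  have z0: "p + z * (a\<^sup>2 - 1) = 0" using a by (simp add: z_def field_simps)
  have "t * ((z * a * b)\<^sup>2 / (q + z * b\<^sup>2)) \<ge> 0"
    using t den[of z] z by simp
  then have "f z \<le> 0" using z0 by (simp add: f_def)
  moreover have "f 0 = p" by (simp add: f_def)
  moreover have "continuous_on {0..z} f"
    unfolding f_def[abs_def] using den by (intro continuous_intros) force
  ultimately obtain x where x: "0 \<le> x" "x \<le> z" "f x = 0"
    using IVT2'[of f z 0 0] z p by auto
  have "x \<noteq> 0" using x \<open>f 0 = p\<close> p by auto
  with x have "x > 0 \<and> f x = 0" by simp
  moreover have "y = x" if "y > 0 \<and> f y = 0" for y
    using dec[of x y] dec[of y x] that calculation by (cases x y rule: linorder_cases) auto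
  ultimately show ?thesis unfolding f_def by blast
qed

text \<open>The feedback multiplies the open-loop gain \<open>a\<close> by
  \<open>q / (q + m * b\<^sup>2)\<close>, which lies between 0 and 1. The left-hand side is thus a
  convex combination of \<open>a\<^sup>2\<close> and a number not exceeding it; this makes the
  variances \<open>s i\<close> positive.\<close>

lemma closed_loop_gain_contractive:
  fixes a b e k m q :: real
  assumes a: "a\<^sup>2 < 1" and e: "0 \<le> e" "e \<le> 1" and q: "q > 0" and m: "m > 0"
    and k: "k = - (m * a * b) / (q + m * b\<^sup>2)"
  shows "e * a\<^sup>2 + (1 - e) * (a + b * k)\<^sup>2 < 1"
proof -
  have d: "q + m * b\<^sup>2 > 0" using q m by (simp add: add_pos_nonneg)
  have "a + b * k = a * (q / (q + m * b\<^sup>2))"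
    using d by (simp add: k field_simps power2_eq_square)
  moreover have "(q / (q + m * b\<^sup>2))\<^sup>2 \<le> 1"
    using d q m by (intro power_le_one) auto
  ultimately have "(a + b * k)\<^sup>2 \<le> a\<^sup>2"
    by (simp only: power_mult_distrib mult_left_le zero_le_power2)
  then have "(1 - e) * (a + b * k)\<^sup>2 \<le> (1 - e) * a\<^sup>2"
    using e by (intro mult_left_mono) auto
  then show ?thesis using a by (simp add: algebra_simps)
qed

theorem theorem6p1:
  fixes a b p q \<sigma> R :: real
    and m k s :: "nat \<Rightarrow> real"
    and \<Phi> :: "nat \<Rightarrow> real \<Rightarrow> real measure"
    and \<pi> :: "nat \<Rightarrow> real measure"
  assumes "a \<noteq> 0" and "b \<noteq> 0" and "\<sigma>\<^sup>2 > 0" and "p > 0" and "q > 0"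
    and "a\<^sup>2 < 1" and "R > 0"
    and "m 1 = (THE x. x > 0 \<and>
           p + x * (a\<^sup>2 - 1) + (x * a * b)\<^sup>2 / (q + x * b\<^sup>2) * (exp (- 2 * R) - 1) = 0)"
    and "m 2 = (THE x. x > 0 \<and>
           p + x * (a\<^sup>2 - 1) - (x * a * b)\<^sup>2 / (q + x * b\<^sup>2) = 0)"
    and "\<And>i. i \<in> {1, 2} \<Longrightarrow> k i = - (m i * a * b) / (q + m i * b\<^sup>2)"
    and "\<And>i. i \<in> {1, 2} \<Longrightarrow>
           s i = \<sigma>\<^sup>2 / (1 - (exp (- 2 * R) * a\<^sup>2 + (1 - exp (- 2 * R)) * (a + b * k i)\<^sup>2))"
    and "\<And>i x. i \<in> {1, 2} \<Longrightarrow>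
           \<Phi> i x = gaussian ((1 - exp (- 2 * R)) * k i * x)
                            ((1 - exp (- 2 * R)) * exp (- 2 * R) * (k i)\<^sup>2 * s i)"
    and "\<And>i. i \<in> {1, 2} \<Longrightarrow> \<pi> i = gaussian 0 (s i)"
  shows
    "(\<exists>!x. x > 0 \<and>
        p + x * (a\<^sup>2 - 1) + (x * a * b)\<^sup>2 / (q + x * b\<^sup>2) * (exp (- 2 * R) - 1) = 0) \<and>
     (\<exists>!x. x > 0 \<and>
        p + x * (a\<^sup>2 - 1) - (x * a * b)\<^sup>2 / (q + x * b\<^sup>2) = 0) \<and>
     (\<forall>i\<in>{1, 2}. s i > 0) \<and>
     optimal_value (lqg_kernel a b (\<sigma>\<^sup>2)) (quadratic_cost p q) R
       \<le> ennreal (min (m 1 * \<sigma>\<^sup>2)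
                      (m 2 * \<sigma>\<^sup>2 + (q + m 2 * b\<^sup>2) * (k 2)\<^sup>2 * s 2 * exp (- 2 * R))) \<and>
     expected_cost (quadratic_cost p q) (\<pi> 1) (\<Phi> 1) = ennreal (m 1 * \<sigma>\<^sup>2) \<and>
     expected_cost (quadratic_cost p q) (\<pi> 2) (\<Phi> 2)
       = ennreal (m 2 * \<sigma>\<^sup>2 + (q + m 2 * b\<^sup>2) * (k 2)\<^sup>2 * s 2 * exp (- 2 * R)) \<and>
     (\<forall>i\<in>{1, 2}. \<Phi> i \<in> info_stable_laws (lqg_kernel a b (\<sigma>\<^sup>2)) (quadratic_cost p q) (\<pi> i) R) \<and>
     (\<forall>i\<in>{1, 2}. mutual_info (\<pi> i) (\<Phi> i) = ereal R)"
proof -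
  define e where "e = exp (- 2 * R)"
  have e: "0 < e" "e < 1" using \<open>R > 0\<close> by (auto simp: e_def)
  note a = \<open>a \<noteq> 0\<close> \<open>a\<^sup>2 < 1\<close> and b = \<open>b \<noteq> 0\<close> and p = \<open>p > 0\<close> and q = \<open>q > 0\<close> and \<sigma> = \<open>\<sigma>\<^sup>2 > 0\<close>
  note k = assms(10) and s_def = assms(11)[folded e_def] and \<Phi>_def = assms(12)[folded e_def]
    and \<pi>_def = assms(13)
  let ?Q = "lqg_kernel a b (\<sigma>\<^sup>2)" and ?c = "quadratic_cost p q"
  have ex1: "\<exists>!x. x > 0 \<and> p + x * (a\<^sup>2 - 1) + (x * a * b)\<^sup>2 / (q + x * b\<^sup>2) * (e - 1) = 0"
  proof -
    have "p + x * (a\<^sup>2 - 1) + y * (e - 1) = p + x * (a\<^sup>2 - 1) - (1 - e) * y" for x y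
      by (simp add: algebra_simps)
    then show ?thesis
      using riccati_unique_root[OF p q a(2), of "1 - e" b] e by simp
  qed
  have ex2: "\<exists>!x. x > 0 \<and> p + x * (a\<^sup>2 - 1) - (x * a * b)\<^sup>2 / (q + x * b\<^sup>2) = 0"
    using riccati_unique_root[OF p q a(2), of 1 b] by simp
  have m1: "m 1 > 0 \<and> p + m 1 * (a\<^sup>2 - 1) + (m 1 * a * b)\<^sup>2 / (q + m 1 * b\<^sup>2) * (e - 1) = 0"
    using theI'[OF ex1] unfolding assms(8)[folded e_def] .
  have m2: "m 2 > 0 \<and> p + m 2 * (a\<^sup>2 - 1) - (m 2 * a * b)\<^sup>2 / (q + m 2 * b\<^sup>2) = 0"
    using theI'[OF ex2] unfolding assms(9) .
  have mpos: "m i > 0" if "i \<in> {1, 2}" for i using that m1 m2 by auto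
  have dpos: "q + m i * b\<^sup>2 > 0" if "i \<in> {1, 2}" for i
    using mpos[OF that] q by (simp add: add_pos_nonneg)
  have km: "k i * (q + m i * b\<^sup>2) = - (m i * a * b)" if "i \<in> {1, 2}" for i
    using dpos[OF that] by (simp add: k[OF that])
  have k0: "k i \<noteq> 0" if "i \<in> {1, 2}" for i
    using mpos[OF that] dpos[OF that] a b by (simp add: k[OF that])
  \<comment> \<open>In terms of the gain, the nonlinear Riccati term is
    \<open>(k i)\<^sup>2 * (q + m i * b\<^sup>2)\<close>, so \<open>p\<close> can be solved for
    explicitly in \<open>p1\<close> and \<open>p2\<close>.\<close>
  have k2: "(m i * a * b)\<^sup>2 / (q + m i * b\<^sup>2) = (k i)\<^sup>2 * (q + m i * b\<^sup>2)" if "i \<in> {1, 2}" for i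
    using dpos[OF that] by (simp add: k[OF that] power_divide power2_eq_square)
  have gain: "e * a\<^sup>2 + (1 - e) * (a + b * k i)\<^sup>2 < 1" if "i \<in> {1, 2}" for i
    by (rule closed_loop_gain_contractive[OF a(2) _ _ q mpos[OF that] k[OF that]]) (use e in auto)
  have spos: "s i > 0" if "i \<in> {1, 2}" for i
    using gain[OF that] \<sigma> by (simp add: s_def[OF that])
  \<comment> \<open>Solving for the noise variance removes the quotient in \<open>s i\<close> and
    makes the later identities polynomial.\<close>
  have \<sigma>_eq: "\<sigma>\<^sup>2 = s i * (1 - (e * a\<^sup>2 + (1 - e) * (a + b * k i)\<^sup>2))" if "i \<in> {1, 2}" for i
    using gain[OF that] by (simp add: s_def[OF that])
  define v where "v i = (1 - e) * e * (k i)\<^sup>2 * s i" for i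
  define c where "c i = (1 - e) * k i" for i
  have vpos: "v i > 0" if "i \<in> {1, 2}" for i
    using spos[OF that] k0[OF that] e by (simp add: v_def)
  have \<Phi>: "\<Phi> i = (\<lambda>x. gaussian (c i * x) (v i))" if "i \<in> {1, 2}" for i
    by (rule ext) (simp add: \<Phi>_def[OF that] c_def v_def)
  \<comment> \<open>The variance of the action:
    \<open>(1 - e)\<^sup>2 + (1 - e) * e = 1 - e\<close>.\<close>
  have var_U: "(c i)\<^sup>2 * s i + v i = (1 - e) * (k i)\<^sup>2 * s i" for i
    by (simp add: c_def v_def power2_eq_square algebra_simps)
  \<comment> \<open>By the same cancellation, the cross term and the square of
    \<open>b * k i\<close> both carry weight \<open>1 - e\<close>, which reproduces
    \<open>e * a\<^sup>2 + (1 - e) * (a + b * k i)\<^sup>2\<close>.\<close>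
  have inv: "s i = (a + b * c i)\<^sup>2 * s i + (b\<^sup>2 * v i + \<sigma>\<^sup>2)" if "i \<in> {1, 2}" for i
    unfolding \<sigma>_eq[OF that] by (simp add: c_def v_def power2_eq_square algebra_simps)
  have cost: "expected_cost ?c (\<pi> i) (\<Phi> i) = ennreal (s i * (p + (1 - e) * q * (k i)\<^sup>2))"
    if "i \<in> {1, 2}" for i
  proof -
    have "(p + q * (c i)\<^sup>2) * s i + q * v i = s i * p + q * ((c i)\<^sup>2 * s i + v i)"
      by (simp add: algebra_simps)
    also have "\<dots> = s i * (p + (1 - e) * q * (k i)\<^sup>2)"
      unfolding var_U by (simp add: algebra_simps)
    finally show ?thesis
      using expected_quadratic_cost_gaussian[OF spos[OF that] vpos[OF that], of p q "c i"] p q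
      by (simp add: \<Phi>[OF that] \<pi>_def[OF that])
  qed
  \<comment> \<open>Multiplying the variance equation by \<open>m i\<close> produces the cross term
    \<open>m i * a * b * k i\<close>, which \<open>km\<close> turns into the Riccati term.\<close>
  have \<sigma>_cost: "m i * \<sigma>\<^sup>2 = s i * (m i * (1 - a\<^sup>2) + 2 * (1 - e) * ((k i)\<^sup>2 * (q + m i * b\<^sup>2))
      - (1 - e) * (m i * b\<^sup>2 * (k i)\<^sup>2))" if "i \<in> {1, 2}" for i
  proof -
    have "m i * \<sigma>\<^sup>2 = s i * (m i * (1 - a\<^sup>2) + 2 * (1 - e) * (k i * (- (m i * a * b)))
        - (1 - e) * (m i * b\<^sup>2 * (k i)\<^sup>2))"
      unfolding \<sigma>_eq[OF that] by (simp add: power2_eq_square algebra_simps)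
    then show ?thesis
      unfolding km[OF that, symmetric] by (simp add: power2_eq_square mult.assoc)
  qed
  have p1: "p = m 1 * (1 - a\<^sup>2) + (1 - e) * ((k 1)\<^sup>2 * (q + m 1 * b\<^sup>2))"
    using m1[THEN conjunct2, unfolded k2[OF insertI1]] by (simp add: algebra_simps)
  have p2: "p = m 2 * (1 - a\<^sup>2) + (k 2)\<^sup>2 * (q + m 2 * b\<^sup>2)"
    using m2 k2[of 2] by (simp add: algebra_simps)
  have cost1: "expected_cost ?c (\<pi> 1) (\<Phi> 1) = ennreal (m 1 * \<sigma>\<^sup>2)"
  proof -
    have "s 1 * (p + (1 - e) * q * (k 1)\<^sup>2) = m 1 * \<sigma>\<^sup>2"
      unfolding \<sigma>_cost[OF insertI1] by (subst p1) (simp add: algebra_simps)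
    then show ?thesis using cost[of 1] by simp
  qed
  \<comment> \<open>The equation for \<open>m 2\<close> carries the Riccati term with weight 1 where
    the cost balance needs \<open>1 - e\<close>; the surplus \<open>e\<close> is the additional
    summand, absent for \<open>m 1\<close>.\<close>
  have cost2: "expected_cost ?c (\<pi> 2) (\<Phi> 2) = ennreal (m 2 * \<sigma>\<^sup>2 + (q + m 2 * b\<^sup>2) * (k 2)\<^sup>2 * s 2 * e)"
  proof -
    have "s 2 * (p + (1 - e) * q * (k 2)\<^sup>2) = m 2 * \<sigma>\<^sup>2 + (q + m 2 * b\<^sup>2) * (k 2)\<^sup>2 * s 2 * e"
      unfolding \<sigma>_cost[of 2, simplified] by (subst p2) (simp add: algebra_simps)
    then show ?thesis using cost[of 2] by simp
  qed
  have info: "mutual_info (\<pi> i) (\<Phi> i) = ereal R" if "i \<in> {1, 2}" for i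
  proof -
    \<comment> \<open>Output variance over noise variance is \<open>1 / e\<close>, because the noise
      is the fraction \<open>e\<close> of the action variance.\<close>
    have "((c i)\<^sup>2 * s i + v i) / v i = exp (2 * R)"
      unfolding var_U using e k0[OF that] spos[OF that] by (simp add: v_def e_def exp_minus field_simps)
    then show ?thesis
      using mutual_info_gaussian_channel[OF spos[OF that] vpos[OF that], of "c i"]
      by (simp add: \<Phi>[OF that] \<pi>_def[OF that])
  qed
  have law: "\<Phi> i \<in> info_stable_laws ?Q ?c (\<pi> i) R" if "i \<in> {1, 2}" for i
    using gaussian_law_stable[OF spos[OF that] vpos[OF that] \<sigma> _ _ inv[OF that], of p q] p q info[OF that]
    by (simp add: info_stable_laws_def \<Phi>[OF that] \<pi>_def[OF that])
  have opt: "optimal_value ?Q ?c R \<le> expected_cost ?c (\<pi> i) (\<Phi> i)" if "i \<in> {1, 2}" for i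
  proof -
    have "\<pi> i \<in> prob_measures"
      using gaussian_in_prob_measures[OF spos[OF that]] by (simp add: \<pi>_def[OF that])
    then show ?thesis
      unfolding optimal_value_def by (rule INF_lower2) (rule INF_lower, rule law[OF that])
  qed
  have "optimal_value ?Q ?c R \<le> ennreal (min (m 1 * \<sigma>\<^sup>2) (m 2 * \<sigma>\<^sup>2 + (q + m 2 * b\<^sup>2) * (k 2)\<^sup>2 * s 2 * e))"
    using opt[of 1] opt[of 2] unfolding cost1 cost2 by (simp add: min_def)
  with ex1 ex2 spos cost1 cost2 law info show ?thesis
    unfolding e_def by (intro conjI ballI)
qed

end
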